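(* For any two connected graphs $G$ and $H$ with $|G| \ge 2$ and $|H| \ge 2$, $md(G \boxtimes H) = 1$.
   Context: The strong product $G \boxtimes H$ has vertex set $V(G)\times V(H)$, with distinct $(u,v)$ and $(u',v')$ adjacent if and only if either $uu' \in E(G)$ and $v=v'$, or $vv' \in E(H)$ and $u=u'$, or $uu'\in E(G)$ and $vv' \in E(H)$. $|G|$ is the number of vertices. An edge-coloring of a graph $G$ is a map $\Gamma: E(G) \to [k]$ (adjacent edges may receive the same color). An edge-cut is monochromatic if all of its edges have the same color. An edge-coloring of $G$ is a monochromatic disconnection coloring (MD-coloring) if any two distinct vertices $u,v$ of $G$ are separated by a monochromatic edge-cut (equivalently, for some color $i$, $u$ and $v$ lie in different components of the graph obtained by deleting all edges of color $i$). For a connected graph $G$, $md(G)$ is the maximum number of colors in an MD-coloring of $G$. *)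

theory Defs
  imports Main
begin

record 'a ugraph =
  verts :: "'a set"
  edges :: "'a set set"

definition simple_graph :: "'a ugraph \<Rightarrow> bool" where
  "simple_graph G \<longleftrightarrow> finite (verts G) \<and> (\<forall>e\<in>edges G. e \<subseteq> verts G \<and> card e = 2)"

definition adj :: "'a ugraph \<Rightarrow> ('a \<times> 'a) set" where
  "adj G = {(u, v). {u, v} \<in> edges G}"

definition same_component :: "'a ugraph \<Rightarrow> 'a \<Rightarrow> 'a \<Rightarrow> bool" where
  "same_component G u v \<longleftrightarrow> u \<in> verts G \<and> v \<in> verts G \<and> (u, v) \<in> (adj G)\<^sup>*"

definition connected_graph :: "'a ugraph \<Rightarrow> bool" where
  "connected_graph G \<longleftrightarrow> verts G \<noteq> {} \<and> (\<forall>u\<in>verts G. \<forall>v\<in>verts G. same_component G u v)"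

definition strong_product :: "'a ugraph \<Rightarrow> 'b ugraph \<Rightarrow> ('a \<times> 'b) ugraph"  (infixl "\<boxtimes>" 70) where
  "G \<boxtimes> H = \<lparr> verts = verts G \<times> verts H,
     edges = {{(u, v), (u', v')} | u v u' v'.
       u \<in> verts G \<and> u' \<in> verts G \<and> v \<in> verts H \<and> v' \<in> verts H \<and> (u, v) \<noteq> (u', v') \<and>
       (({u, u'} \<in> edges G \<and> v = v') \<or>
        ({v, v'} \<in> edges H \<and> u = u') \<or>
        ({u, u'} \<in> edges G \<and> {v, v'} \<in> edges H))} \<rparr>"

definition delete_edges :: "'a ugraph \<Rightarrow> 'a set set \<Rightarrow> 'a ugraph" where
  "delete_edges G F = \<lparr> verts = verts G, edges = edges G - F \<rparr>"

definition edge_cut :: "'a ugraph \<Rightarrow> 'a set set \<Rightarrow> bool" where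
  "edge_cut G F \<longleftrightarrow> F \<subseteq> edges G \<and> \<not> connected_graph (delete_edges G F)"

definition separates :: "'a ugraph \<Rightarrow> 'a set set \<Rightarrow> 'a \<Rightarrow> 'a \<Rightarrow> bool" where
  "separates G F u v \<longleftrightarrow> \<not> same_component (delete_edges G F) u v"

definition edge_coloring :: "'a ugraph \<Rightarrow> nat \<Rightarrow> ('a set \<Rightarrow> nat) \<Rightarrow> bool" where
  "edge_coloring G k \<Gamma> \<longleftrightarrow> (\<forall>e\<in>edges G. \<Gamma> e \<in> {1..k})"

definition monochromatic :: "('a set \<Rightarrow> nat) \<Rightarrow> 'a set set \<Rightarrow> bool" where
  "monochromatic \<Gamma> F \<longleftrightarrow> (\<forall>e\<in>F. \<forall>e'\<in>F. \<Gamma> e = \<Gamma> e')"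

definition MD_coloring :: "'a ugraph \<Rightarrow> nat \<Rightarrow> ('a set \<Rightarrow> nat) \<Rightarrow> bool" where
  "MD_coloring G k \<Gamma> \<longleftrightarrow> edge_coloring G k \<Gamma> \<and>
     (\<forall>u\<in>verts G. \<forall>v\<in>verts G. u \<noteq> v \<longrightarrow>
        (\<exists>F. edge_cut G F \<and> monochromatic \<Gamma> F \<and> separates G F u v))"

text \<open>The number of colors of a coloring into \<open>[k]\<close> is the number of colors that actually occur,
  so that enlarging \<open>k\<close> without using the extra colors does not count.\<close>

definition md :: "'a ugraph \<Rightarrow> nat" where
  "md G = Max {card (\<Gamma> ` edges G) | \<Gamma> k. MD_coloring G k \<Gamma>}"

text \<open>For finite simple graphs the maximum ranges over a finite nonempty set.\<close>

lemma simple_graph_finite_edges: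
  assumes "simple_graph G"
  shows "finite (edges G)"
proof -
  have "edges G \<subseteq> Pow (verts G)" using assms by (auto simp: simple_graph_def)
  then show ?thesis using assms finite_subset by (auto simp: simple_graph_def)
qed

lemma md_set_finite:
  assumes "simple_graph G"
  shows "finite {card (\<Gamma> ` edges G) | \<Gamma> k. MD_coloring G k \<Gamma>}"
  by (rule finite_subset[of _ "{..card (edges G)}"])
    (auto intro: card_image_le simple_graph_finite_edges[OF assms])

lemma md_set_nonempty: "{card (\<Gamma> ` edges G) | \<Gamma> k. MD_coloring G k \<Gamma>} \<noteq> {}"
proof -
  have "MD_coloring G 1 (\<lambda>_. 1)"
    unfolding MD_coloring_def
  proof (intro conjI ballI impI)
    show "edge_coloring G 1 (\<lambda>_. 1)" by (simp add: edge_coloring_def)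
  next
    fix u v assume uv: "u \<in> verts G" "v \<in> verts G" "u \<noteq> v"
    have "adj (delete_edges G (edges G)) = {}" by (simp add: adj_def delete_edges_def)
    then have n: "\<not> same_component (delete_edges G (edges G)) u v"
      using uv(3) by (simp add: same_component_def)
    then have "edge_cut G (edges G)"
      using uv by (auto simp: edge_cut_def connected_graph_def delete_edges_def)
    then show "\<exists>F. edge_cut G F \<and> monochromatic (\<lambda>_. 1) F \<and> separates G F u v"
      using n by (auto simp: monochromatic_def separates_def)
  qed
  then show ?thesis by blast
qed

lemma simple_graph_strong_product:
  assumes "simple_graph G" "simple_graph H"
  shows "simple_graph (G \<boxtimes> H)"
  using assms unfolding simple_graph_def strong_product_def
  by (auto simp: card_insert_if)

end

theory Submission imports Defs begin

text \<open>A monochromatic cut separating the ends of an edge contains that edge and meets every path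
  between its ends, so in an MD-coloring every triangle is monochromatic. In \<open>G \<boxtimes> H\<close> an edge
  \<open>uu'\<close> of \<open>G\<close> and an edge \<open>vv'\<close> of \<open>H\<close> span a \<open>K\<^sub>4\<close>, which is therefore monochromatic, and two such
  copies of \<open>K\<^sub>4\<close> that come from adjacent edges of one factor share an edge. Connectedness of \<open>G\<close> and
  \<open>H\<close> then spreads a single color over the whole product.\<close>

lemma sym_adj: "(u, v) \<in> adj G \<Longrightarrow> (v, u) \<in> adj G"
  by (simp add: adj_def insert_commute)

lemma simple_graph_adjD:
  assumes "simple_graph G" "(u, v) \<in> adj G"
  shows "u \<in> verts G" "v \<in> verts G" "u \<noteq> v"
  using assms by (fastforce simp: simple_graph_def adj_def)+

text \<open>A cut separating \<open>x\<close> from \<open>z\<close> contains the edge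
  \<open>xz\<close> and breaks the path \<open>x\<close>, \<open>y\<close>, \<open>z\<close>. Which
  of the two path edges it contains is left open, hence the disjunction.\<close>

lemma MD_coloring_triangle_side:
  assumes G: "simple_graph G" and MD: "MD_coloring G k \<Gamma>"
    and xy: "(x, y) \<in> adj G" and yz: "(y, z) \<in> adj G" and xz: "(x, z) \<in> adj G"
  shows "\<Gamma> {x, z} = \<Gamma> {x, y} \<or> \<Gamma> {x, z} = \<Gamma> {y, z}"
proof -
  note vs = simple_graph_adjD[OF G xz]
  obtain F where mono: "monochromatic \<Gamma> F" and sep: "separates G F x z"
    using MD vs unfolding MD_coloring_def by blast
  let ?D = "delete_edges G F"
  have nr: "(x, z) \<notin> (adj ?D)\<^sup>*"
    using sep vs by (simp add: separates_def same_component_def delete_edges_def)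
  have kept: "(a, b) \<in> adj ?D" if "(a, b) \<in> adj G" "{a, b} \<notin> F" for a b
    using that by (simp add: adj_def delete_edges_def)
  have "{x, z} \<in> F"
    using nr kept[OF xz] by blast
  moreover have "{x, y} \<in> F \<or> {y, z} \<in> F"
    using nr kept[OF xy] kept[OF yz] by (meson r_into_rtrancl rtrancl_trans)
  ultimately show ?thesis
    using mono unfolding monochromatic_def by blast
qed

text \<open>No side can differ in color from both others, and among three sides with at least two
  colors some side would.\<close>

lemma MD_coloring_triangle:
  assumes G: "simple_graph G" and MD: "MD_coloring G k \<Gamma>"
    and xy: "(x, y) \<in> adj G" and yz: "(y, z) \<in> adj G" and xz: "(x, z) \<in> adj G"
  shows "\<Gamma> {x, y} = \<Gamma> {x, z}" and "\<Gamma> {y, z} = \<Gamma> {x, z}"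
proof -
  note side = MD_coloring_triangle_side[OF G MD]
  have "\<Gamma> {x, z} = \<Gamma> {x, y} \<or> \<Gamma> {x, z} = \<Gamma> {y, z}"
    by (rule side[OF xy yz xz])
  moreover have "\<Gamma> {x, y} = \<Gamma> {x, z} \<or> \<Gamma> {x, y} = \<Gamma> {y, z}"
    using side[OF xz sym_adj[OF yz] xy] by (simp add: insert_commute)
  moreover have "\<Gamma> {y, z} = \<Gamma> {x, y} \<or> \<Gamma> {y, z} = \<Gamma> {x, z}"
    using side[OF sym_adj[OF xy] xz yz] by (simp add: insert_commute)
  ultimately show "\<Gamma> {x, y} = \<Gamma> {x, z}" and "\<Gamma> {y, z} = \<Gamma> {x, z}"
    by argo+
qed

text \<open>The first edge of a path to a second vertex will do. This supplies the edge of the other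
  factor needed to complete a \<open>K4\<close>.\<close>

lemma connected_graph_neighbour:
  assumes "connected_graph G" and "card (verts G) \<ge> 2" and "u \<in> verts G"
  obtains u' where "(u, u') \<in> adj G"
proof -
  have "\<not> verts G \<subseteq> {u}"
    using assms(2) card_mono[of "{u}" "verts G"] by auto
  then obtain w where w: "w \<in> verts G" "w \<noteq> u" by blast
  then have "(u, w) \<in> (adj G)\<^sup>*"
    using assms by (auto simp: connected_graph_def same_component_def)
  then show thesis
  proof (cases rule: converse_rtranclE)
    case base
    then show thesis using w(2) by simp
  next
    case (step u')
    then show thesis using that by simp
  qed
qed

text \<open>Meant for \<open>f\<close> that sends a vertex of one factor to the color of the copy,
  at that vertex, of a fixed edge of the other factor.\<close>

lemma connected_graph_constant:
  assumes "connected_graph G" and "\<And>a b. (a, b) \<in> adj G \<Longrightarrow> f a = f b"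
    and "u \<in> verts G" and "v \<in> verts G"
  shows "f u = f v"
proof -
  have "(u, v) \<in> (adj G)\<^sup>*"
    using assms by (auto simp: connected_graph_def same_component_def)
  then show ?thesis
    by induction (auto dest: assms(2))
qed

lemma edges_strong_product_cases:
  assumes "e \<in> edges (G \<boxtimes> H)"
  obtains (horizontal) u u' v where "e = {(u, v), (u', v)}" "(u, u') \<in> adj G" "v \<in> verts H"
  | (vertical) u v v' where "e = {(u, v), (u, v')}" "u \<in> verts G" "(v, v') \<in> adj H"
  | (diagonal) u u' v v' where "e = {(u, v), (u', v')}" "(u, u') \<in> adj G" "(v, v') \<in> adj H"
  using assms unfolding strong_product_def adj_def by auto

lemma adj_strong_productI:
  assumes "simple_graph G" and "simple_graph H"
  shows "(u, u') \<in> adj G \<Longrightarrow> v \<in> verts H \<Longrightarrow> ((u, v), (u', v)) \<in> adj (G \<boxtimes> H)"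
    and "u \<in> verts G \<Longrightarrow> (v, v') \<in> adj H \<Longrightarrow> ((u, v), (u, v')) \<in> adj (G \<boxtimes> H)"
    and "(u, u') \<in> adj G \<Longrightarrow> (v, v') \<in> adj H \<Longrightarrow> ((u, v), (u', v')) \<in> adj (G \<boxtimes> H)"
  using simple_graph_adjD[OF assms(1), of u u'] simple_graph_adjD[OF assms(2), of v v']
  unfolding strong_product_def adj_def by auto

text \<open>The diagonal lies in two triangles of the \<open>K4\<close>, one through
  \<open>(u', v)\<close> and one through \<open>(u, v')\<close>, so it links the horizontal and the
  vertical edge at \<open>(u, v)\<close>.\<close>

lemma MD_coloring_strong_product_block:
  assumes "simple_graph G" and "simple_graph H" and "MD_coloring (G \<boxtimes> H) k \<Gamma>"
    and "(u, u') \<in> adj G" and "(v, v') \<in> adj H"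
  shows "\<Gamma> {(u, v), (u', v)} = \<Gamma> {(u, v), (u, v')}"
    and "\<Gamma> {(u, v), (u', v')} = \<Gamma> {(u, v), (u', v)}"
proof -
  note T = MD_coloring_triangle[OF simple_graph_strong_product[OF assms(1,2)] assms(3)]
  note A = adj_strong_productI[OF assms(1,2)]
  note vs = simple_graph_adjD[OF assms(1,4)] simple_graph_adjD[OF assms(2,5)]
  show d: "\<Gamma> {(u, v), (u', v')} = \<Gamma> {(u, v), (u', v)}"
    using T(1)[of "(u, v)" "(u', v)" "(u', v')"] A assms(4,5) vs by simp
  show "\<Gamma> {(u, v), (u', v)} = \<Gamma> {(u, v), (u, v')}"
    using T(1)[of "(u, v)" "(u, v')" "(u', v')"] A assms(4,5) vs d by simp
qed

lemma MD_coloring_strong_product_constant: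
  assumes G: "simple_graph G" "connected_graph G" "card (verts G) \<ge> 2"
    and H: "simple_graph H" "connected_graph H" "card (verts H) \<ge> 2"
    and MD: "MD_coloring (G \<boxtimes> H) k \<Gamma>"
  obtains c where "\<And>e. e \<in> edges (G \<boxtimes> H) \<Longrightarrow> \<Gamma> e = c"
proof -
  note block = MD_coloring_strong_product_block[OF G(1) H(1) MD]
  obtain u0 v0 where u0: "u0 \<in> verts G" and v0: "v0 \<in> verts H"
    using G(2) H(2) by (auto simp: connected_graph_def)
  obtain v1 where v1: "(v0, v1) \<in> adj H"
    using connected_graph_neighbour[OF H(2,3) v0] .
  \<comment> \<open>Every horizontal edge is compared with this vertical one: slide it to row
    \<open>v0\<close>, turn it into a copy of \<open>v0 v1\<close>, then slide that copy to column
    \<open>u0\<close>.\<close>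
  define c where "c = \<Gamma> {(u0, v0), (u0, v1)}"
  have hor: "\<Gamma> {(u, v), (u', v)} = c" if u: "(u, u') \<in> adj G" and v: "v \<in> verts H" for u u' v
  proof -
    \<comment> \<open>Both horizontal edges have the color of the vertical edge from
      \<open>(u, a)\<close> to \<open>(u, b)\<close>.\<close>
    have "\<Gamma> {(u, a), (u', a)} = \<Gamma> {(u, b), (u', b)}" if "(a, b) \<in> adj H" for a b
      using block(1)[OF u that] block(1)[OF u sym_adj[OF that]] by (simp add: insert_commute)
    then have "\<Gamma> {(u, v), (u', v)} = \<Gamma> {(u, v0), (u', v0)}"
      using connected_graph_constant[OF H(2), of "\<lambda>a. \<Gamma> {(u, a), (u', a)}"] v v0 by blast
    also have "\<dots> = \<Gamma> {(u, v0), (u, v1)}"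
      by (rule block(1)[OF u v1])
    also have "\<dots> = c"
    proof -
      \<comment> \<open>Here the horizontal edge from \<open>(a, v0)\<close> to
        \<open>(b, v0)\<close> is the link.\<close>
      have "\<Gamma> {(a, v0), (a, v1)} = \<Gamma> {(b, v0), (b, v1)}" if "(a, b) \<in> adj G" for a b
        using block(1)[OF that v1] block(1)[OF sym_adj[OF that] v1] by (simp add: insert_commute)
      then show ?thesis
        unfolding c_def
        using connected_graph_constant[OF G(2), of "\<lambda>a. \<Gamma> {(a, v0), (a, v1)}"]
          simple_graph_adjD(1)[OF G(1) u] u0 by blast
    qed
    finally show ?thesis .
  qed
  have "\<Gamma> e = c" if "e \<in> edges (G \<boxtimes> H)" for e
    using that
  proof (cases rule: edges_strong_product_cases)
    case (horizontal u u' v)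
    then show ?thesis using hor by simp
  next
    case (vertical u v v')
    \<comment> \<open>Any edge of \<open>G\<close> at \<open>u\<close> places the vertical edge in a
      \<open>K4\<close> with a horizontal edge, whose color is known.\<close>
    obtain u' where "(u, u') \<in> adj G"
      using connected_graph_neighbour[OF G(2,3) vertical(2)] .
    then show ?thesis
      using vertical block(1) hor simple_graph_adjD(1)[OF H(1) vertical(3)] by metis
  next
    case (diagonal u u' v v')
    then show ?thesis
      using block(2) hor simple_graph_adjD(1)[OF H(1) diagonal(3)] by metis
  qed
  then show thesis using that by blast
qed

theorem theorem4p5:
  fixes G :: "'a ugraph" and H :: "'b ugraph"
  assumes "simple_graph G" and "simple_graph H"
    and "connected_graph G" and "connected_graph H"
    and "card (verts G) \<ge> 2" and "card (verts H) \<ge> 2"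
  shows "md (G \<boxtimes> H) = 1"
proof -
  obtain u v where u: "u \<in> verts G" and v: "v \<in> verts H"
    using assms(3,4) by (auto simp: connected_graph_def)
  obtain u' where "(u, u') \<in> adj G"
    using connected_graph_neighbour[OF assms(3,5) u] .
  \<comment> \<open>An actual edge of the product is needed: with no edges the number of colors
    would be 0.\<close>
  then have e: "{(u, v), (u', v)} \<in> edges (G \<boxtimes> H)"
    using adj_strong_productI(1)[OF assms(1,2) _ v] by (simp add: adj_def)
  let ?S = "{card (\<Gamma> ` edges (G \<boxtimes> H)) | \<Gamma> k. MD_coloring (G \<boxtimes> H) k \<Gamma>}"
  have "card (\<Gamma> ` edges (G \<boxtimes> H)) = 1" if MD: "MD_coloring (G \<boxtimes> H) k \<Gamma>" for \<Gamma> k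
  proof -
    obtain c where "\<forall>e \<in> edges (G \<boxtimes> H). \<Gamma> e = c"
      using MD_coloring_strong_product_constant[OF assms(1,3,5) assms(2,4,6) MD] by metis
    then have "\<Gamma> ` edges (G \<boxtimes> H) = (\<lambda>_. c) ` edges (G \<boxtimes> H)"
      by (intro image_cong) simp_all
    also have "\<dots> = {c}"
      using e by (rule image_constant)
    finally show ?thesis by simp
  qed
  then have "?S \<subseteq> {1}" by auto
  then have "?S = {1}"
    using md_set_nonempty[of "G \<boxtimes> H"] by (simp only: subset_singleton_iff simp_thms)
  then show ?thesis
    by (simp add: md_def)
qed

end
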